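(* Let $G_\sigma>0$. There exist a two-state Markov chain and a stochastic gradient oracle satisfying the assumptions (1)–(4) of the context (with centered-noise constant $G_\sigma$) such that, for every $T\ge2$, the unclipped initial error $s_0^{\mathrm{pre}}=\hat g_0(x_0)-\nabla f(x_0)$ satisfies $$\operatorname{ess\,sup}\|s_0^{\mathrm{pre}}\|\ \ge\ (T/2-1)\,G_\sigma .$$
   Context: $\|\cdot\|$ is the Euclidean norm; $\mathcal X\subset\mathbb R^n$ is a compact convex set, $x_0\in\mathcal X$, and $f(x)=\mathbb E_{z\sim\pi}[f(x;z)]$. Assumptions. (1) For every $z\in\mathcal Z$, $f(\cdot;z)$ is differentiable on $\mathcal X$ with $\|\nabla f(x;z)-\nabla f(y;z)\|\le L\|x-y\|$ for all $x,y\in\mathcal X$, and $\mathbb E_\pi[\nabla f(x;z)]=\nabla f(x)$ on $\mathcal X$. (2) $\|\nabla f(x)\|\le G$ on $\mathcal X$ for a finite $G$, and a constant $\widehat G\ge G$ is available. (3) $\sup_{x\in\mathcal X,z\in\mathcal Z}\|\nabla f(x;z)-\nabla f(x)\|\le G_\sigma$. (4) Samples are successive states of a time-homogeneous ergodic Markov chain on $\mathcal Z$ with kernel $P$ and stationary distribution $\pi$; with $d_{\mathrm{mix}}(k)=\sup_zd_{\mathrm{TV}}(P^k(z,\cdot),\pi)$, $\tau_{\mathrm{mix}}=\min\{k\ge1:d_{\mathrm{mix}}(k)\le1/4\}<\infty$. The initial state may be deterministic or random. Estimator. Let $T$ be the horizon and $j_{\max}=\lfloor\log_2T\rfloor$.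 Draw $J_0$ with $\Pr[J_0=j]=2^{-j}$, $j\ge1$, independently of the chain. Let $z_0^{(1)},z_0^{(2)},\dots$ be the consecutive chain states following the initial state ($2^{J_0}$ of them are used if $J_0\le j_{\max}$, one otherwise), $\hat\mu^j[\varphi]=2^{-j}\sum_{i=1}^{2^j}\varphi(z_0^{(i)})$, and $$\hat g_0(x_0)=\hat\mu^0[\varphi]+2^{J_0}\big(\hat\mu^{J_0}[\varphi]-\hat\mu^{J_0-1}[\varphi]\big)\mathbf 1\{J_0\le j_{\max}\},\qquad\varphi(z)=\nabla f(x_0;z).$$ This is the algorithm's gradient estimate at iteration $0$ before it is clipped to the ball of radius $\widehat G$. *)

theory Defs
  imports "HOL-Probability.Probability"
begin

section \<open>Finite-state Markov chains\<close>

text \<open>A time-homogeneous kernel on a finite state space \<^typ>\<open>'s\<close> is a function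
  \<^typ>\<open>'s \<Rightarrow> 's pmf\<close>.  The discrete sigma-algebra makes all integrability and
  measurability conditions on functions of the state automatic.\<close>

fun kernel_power :: "('s \<Rightarrow> 's pmf) \<Rightarrow> nat \<Rightarrow> 's \<Rightarrow> 's pmf" where
  "kernel_power P 0 z = return_pmf z"
| "kernel_power P (Suc k) z = bind_pmf (kernel_power P k z) P"

definition irreducible_kernel :: "('s \<Rightarrow> 's pmf) \<Rightarrow> bool" where
  "irreducible_kernel P \<longleftrightarrow> (\<forall>x y. \<exists>k. pmf (kernel_power P k x) y > 0)"

definition aperiodic_kernel :: "('s \<Rightarrow> 's pmf) \<Rightarrow> bool" where
  "aperiodic_kernel P \<longleftrightarrow> (\<forall>x. Gcd {k. 1 \<le> k \<and> pmf (kernel_power P k x) x > 0} = (1::nat))"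

definition ergodic_kernel :: "('s::finite \<Rightarrow> 's pmf) \<Rightarrow> bool" where
  "ergodic_kernel P \<longleftrightarrow> irreducible_kernel P \<and> aperiodic_kernel P"

definition stationary :: "('s \<Rightarrow> 's pmf) \<Rightarrow> 's pmf \<Rightarrow> bool" where
  "stationary P \<pi> \<longleftrightarrow> bind_pmf \<pi> P = \<pi>"

definition d_TV :: "'s pmf \<Rightarrow> 's pmf \<Rightarrow> real" where
  "d_TV p q = (SUP A. \<bar>measure_pmf.prob p A - measure_pmf.prob q A\<bar>)"

definition d_mix :: "('s \<Rightarrow> 's pmf) \<Rightarrow> 's pmf \<Rightarrow> nat \<Rightarrow> real" where
  "d_mix P \<pi> k = (SUP z. d_TV (kernel_power P k z) \<pi>)"

text \<open>The infimum is \<^term>\<open>\<infinity>\<close> if there is no such \<open>k\<close>, and the minimum otherwise.\<close>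

definition tau_mix :: "('s \<Rightarrow> 's pmf) \<Rightarrow> 's pmf \<Rightarrow> enat" where
  "tau_mix P \<pi> = (INF k \<in> {k. 1 \<le> k \<and> d_mix P \<pi> k \<le> 1/4}. enat k)"

text \<open>The law on path space of the chain with initial distribution \<open>\<nu>\<close> and kernel \<open>P\<close>, given by
  the Ionescu-Tulcea theorem; the coordinate \<open>\<omega> 0\<close> is the initial state.  The finite-dimensional
  distributions are computed in \<open>measure_chain_cylinder\<close> below.\<close>

definition chain_step :: "'s pmf \<Rightarrow> ('s \<Rightarrow> 's pmf) \<Rightarrow> nat \<Rightarrow> (nat \<Rightarrow> 's) \<Rightarrow> 's measure" where
  "chain_step \<nu> P i \<omega> = measure_pmf (if i = 0 then \<nu> else P (\<omega> (i - 1)))"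

definition chain_measure :: "'s pmf \<Rightarrow> ('s \<Rightarrow> 's pmf) \<Rightarrow> (nat \<Rightarrow> 's) measure" where
  "chain_measure \<nu> P =
     projective_family.lim UNIV
       (Ionescu_Tulcea.CI (chain_step \<nu> P) (\<lambda>_. count_space UNIV)) (\<lambda>_. count_space UNIV)"


section \<open>Stochastic gradient oracles\<close>

text \<open>The gradient operator; meaningful where the function is differentiable.\<close>

definition gradient :: "('a::real_inner \<Rightarrow> real) \<Rightarrow> 'a \<Rightarrow> 'a" where
  "gradient g x = (THE D. GDERIV g x :> D)"

definition objective :: "'s pmf \<Rightarrow> ('a \<Rightarrow> 's \<Rightarrow> real) \<Rightarrow> 'a \<Rightarrow> real" where
  "objective \<pi> F x = measure_pmf.expectation \<pi> (F x)"

definition smooth_unbiased_oracle ::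
    "'a::euclidean_space set \<Rightarrow> real \<Rightarrow> 's::finite pmf \<Rightarrow> ('a \<Rightarrow> 's \<Rightarrow> real) \<Rightarrow> bool" where
  "smooth_unbiased_oracle X L \<pi> F \<longleftrightarrow>
     (\<forall>z. (\<forall>x\<in>X. (\<lambda>y. F y z) differentiable at x) \<and>
          (\<forall>x\<in>X. \<forall>y\<in>X. norm (gradient (\<lambda>u. F u z) x - gradient (\<lambda>u. F u z) y)
                          \<le> L * norm (x - y))) \<and>
     (\<forall>x\<in>X. objective \<pi> F differentiable at x \<and>
        measure_pmf.expectation \<pi> (\<lambda>z. gradient (\<lambda>u. F u z) x) = gradient (objective \<pi> F) x)"

definition bounded_gradient ::
    "'a::euclidean_space set \<Rightarrow> real \<Rightarrow> 's::finite pmf \<Rightarrow> ('a \<Rightarrow> 's \<Rightarrow> real) \<Rightarrow> bool" where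
  "bounded_gradient X G \<pi> F \<longleftrightarrow> (\<forall>x\<in>X. norm (gradient (objective \<pi> F) x) \<le> G)"

definition bounded_noise ::
    "'a::euclidean_space set \<Rightarrow> real \<Rightarrow> 's::finite pmf \<Rightarrow> ('a \<Rightarrow> 's \<Rightarrow> real) \<Rightarrow> bool" where
  "bounded_noise X G\<sigma> \<pi> F \<longleftrightarrow>
     (\<forall>x\<in>X. \<forall>z. norm (gradient (\<lambda>u. F u z) x - gradient (objective \<pi> F) x) \<le> G\<sigma>)"

definition ergodic_sampling :: "('s::finite \<Rightarrow> 's pmf) \<Rightarrow> 's pmf \<Rightarrow> bool" where
  "ergodic_sampling P \<pi> \<longleftrightarrow> ergodic_kernel P \<and> stationary P \<pi> \<and> tau_mix P \<pi> < \<infinity>"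


section \<open>The multilevel estimator\<close>

definition j_max :: "nat \<Rightarrow> nat" where
  "j_max T = nat \<lfloor>log 2 (real T)\<rfloor>"

text \<open>The level distribution, of mass \<open>2 powr - j\<close> at every \<open>j \<ge> 1\<close>.\<close>

definition level_pmf :: "nat pmf" where
  "level_pmf = map_pmf Suc (geometric_pmf (1/2))"

lemma pmf_level_pmf: "pmf level_pmf j = (if 1 \<le> j then 1 / 2 ^ j else 0)"
proof (cases j)
  case 0
  then show ?thesis by (auto simp: level_pmf_def pmf_eq_0_set_pmf)
next
  case (Suc k)
  then show ?thesis
    by (simp add: level_pmf_def pmf_map_inj' power_divide)
qed

text \<open>In \<open>\<omega>\<close>, index \<open>0\<close> is the initial state, which is not itself used as a sample.\<close>

definition level_mean :: "nat \<Rightarrow> ('s \<Rightarrow> 'a::real_vector) \<Rightarrow> (nat \<Rightarrow> 's) \<Rightarrow> 'a" where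
  "level_mean j \<phi> \<omega> = (1 / 2 ^ j) *\<^sub>R (\<Sum>i = 1..2 ^ j. \<phi> (\<omega> i))"

definition mlmc_estimate ::
    "nat \<Rightarrow> ('s \<Rightarrow> 'a::real_vector) \<Rightarrow> nat \<Rightarrow> (nat \<Rightarrow> 's) \<Rightarrow> 'a" where
  "mlmc_estimate T \<phi> j \<omega> =
     level_mean 0 \<phi> \<omega> +
     (if j \<le> j_max T then 2 ^ j *\<^sub>R (level_mean j \<phi> \<omega> - level_mean (j - 1) \<phi> \<omega>) else 0)"

text \<open>The probability space carrying the level and an independent path of the chain.\<close>

definition sampling_space :: "'s pmf \<Rightarrow> ('s \<Rightarrow> 's pmf) \<Rightarrow> (nat \<times> (nat \<Rightarrow> 's)) measure" where
  "sampling_space \<nu> P = measure_pmf level_pmf \<Otimes>\<^sub>M chain_measure \<nu> P"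

definition initial_error ::
    "'s pmf \<Rightarrow> ('a::euclidean_space \<Rightarrow> 's \<Rightarrow> real) \<Rightarrow> 'a \<Rightarrow> nat \<Rightarrow> nat \<times> (nat \<Rightarrow> 's) \<Rightarrow> 'a" where
  "initial_error \<pi> F x\<^sub>0 T = (\<lambda>(j, \<omega>).
     mlmc_estimate T (\<lambda>z. gradient (\<lambda>u. F u z) x\<^sub>0) j \<omega> - gradient (objective \<pi> F) x\<^sub>0)"


section \<open>Basic facts\<close>

lemma gradient_eqI:
  fixes x :: "'a::euclidean_space"
  assumes "GDERIV g x :> D"
  shows "gradient g x = D"
  unfolding gradient_def
proof (rule the_equality)
  show "GDERIV g x :> D" by fact
next
  fix E assume "GDERIV g x :> E"
  with assms have "(\<lambda>h. inner h D) = (\<lambda>h. inner h E)"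
    unfolding gderiv_def by (rule has_derivative_unique)
  then have "inner (D - E) D = inner (D - E) E"
    by (rule fun_cong)
  then have "inner (D - E) (D - E) = 0"
    by (simp add: inner_diff_right)
  then show "E = D"
    by simp
qed

lemma GDERIV_gradient:
  fixes x :: "'a::euclidean_space"
  assumes "g differentiable at x"
  shows "GDERIV g x :> gradient g x"
proof -
  obtain g' where g': "(g has_derivative g') (at x)"
    using assms by (auto simp: differentiable_def)
  then have l: "bounded_linear g'"
    by (rule has_derivative_bounded_linear)
  define D where "D = (\<Sum>b\<in>Basis. g' b *\<^sub>R b)"
  have "g' h = inner h D" for h
  proof -
    have "g' h = g' (\<Sum>b\<in>Basis. inner h b *\<^sub>R b)"
      by (simp add: euclidean_representation)
    also have "\<dots> = (\<Sum>b\<in>Basis. inner h b * g' b)"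
      using l by (simp add: linear_sum linear_cmul bounded_linear.linear)
    also have "\<dots> = inner h D"
      by (simp add: D_def inner_sum_right mult.commute)
    finally show ?thesis .
  qed
  then have "g' = (\<lambda>h. inner h D)"
    by (rule ext)
  then have D: "GDERIV g x :> D"
    using g' unfolding gderiv_def by simp
  show ?thesis
    unfolding gradient_eqI[OF D] by (rule D)
qed

lemma Ionescu_Tulcea_chain:
  "Ionescu_Tulcea (chain_step (\<nu> :: 's::finite pmf) P) (\<lambda>_. count_space UNIV)"
proof (rule Ionescu_Tulcea.intro)
  fix i :: nat
  have P: "(\<lambda>z. measure_pmf (P z)) \<in> count_space UNIV \<rightarrow>\<^sub>M subprob_algebra (count_space UNIV)"
    by (auto simp: space_subprob_algebra intro!: prob_space_imp_subprob_space prob_space_measure_pmf)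
  show "chain_step \<nu> P i \<in> PiM {0..<i} (\<lambda>_. count_space UNIV) \<rightarrow>\<^sub>M subprob_algebra (count_space UNIV)"
  proof (cases "i = 0")
    case True
    then show ?thesis
      by (auto simp: chain_step_def[abs_def] space_subprob_algebra
          intro!: measurable_const prob_space_imp_subprob_space prob_space_measure_pmf)
  next
    case False
    then have "(\<lambda>\<omega>. \<omega> (i - 1)) \<in> PiM {0..<i} (\<lambda>_. count_space (UNIV :: 's set)) \<rightarrow>\<^sub>M count_space UNIV"
      by (intro measurable_component_singleton) auto
    from measurable_compose[OF this P] False show ?thesis
      by (simp add: chain_step_def[abs_def])
  qed
next
  fix i :: nat and \<omega> :: "nat \<Rightarrow> 's"
  show "prob_space (chain_step \<nu> P i \<omega>)"
    by (simp add: chain_step_def prob_space_measure_pmf)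
qed

lemma sets_chain_measure [measurable_cong]:
  "sets (chain_measure (\<nu> :: 's::finite pmf) P) = sets (PiM UNIV (\<lambda>_. count_space UNIV))"
proof -
  interpret Ionescu_Tulcea "chain_step \<nu> P" "\<lambda>_. count_space UNIV"
    by (rule Ionescu_Tulcea_chain)
  show ?thesis
    unfolding chain_measure_def by (rule PF.sets_lim)
qed

lemma space_chain_measure [simp]: "space (chain_measure (\<nu> :: 's::finite pmf) P) = UNIV"
  using sets_eq_imp_space_eq[OF sets_chain_measure, of \<nu> P] by (simp add: space_PiM)

lemma emeasure_chain_cylinder:
  fixes \<nu> :: "'s::finite pmf"
  shows "emeasure (chain_measure \<nu> P) {\<omega>. \<forall>i\<le>n. \<omega> i = z i} =
           ennreal (pmf \<nu> (z 0) * (\<Prod>i<n. pmf (P (z i)) (z (Suc i))))"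
proof -
  interpret Ionescu_Tulcea "chain_step \<nu> P" "\<lambda>_. count_space UNIV"
    by (rule Ionescu_Tulcea_chain)
  let ?M = "\<lambda>n. PiM {0..<n} (\<lambda>_. count_space (UNIV :: 's set))"
  let ?r = "\<lambda>n. restrict z {0..<n}"
  have meas: "{?r n} \<in> sets (?M n)" for n
  proof -
    have "PiE {0..<n} (\<lambda>i. {z i}) \<in> sets (?M n)"
      by (rule sets_PiM_I_finite) auto
    also have "PiE {0..<n} (\<lambda>i. {z i}) = {?r n}"
      by (auto simp: PiE_iff extensional_def fun_eq_iff)
    finally show ?thesis .
  qed
  have step: "emeasure (C 0 (Suc n) (\<lambda>_. undefined)) {?r (Suc n)} =
      emeasure (C 0 n (\<lambda>_. undefined)) {?r n} * emeasure (chain_step \<nu> P n (?r n)) {z n}" for n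
  proof -
    have u: "(\<lambda>_. undefined) \<in> space (?M 0)"
      by (simp add: space_PiM PiE_def extensional_def)
    have sp: "space (C 0 n (\<lambda>_. undefined)) = space (?M n)"
      using space_C[OF u] by simp
    have st: "sets (C 0 n (\<lambda>_. undefined)) = sets (?M n)"
      using sets_C[OF u] by simp
    have "emeasure (C 0 (Suc n) (\<lambda>_. undefined)) {?r (Suc n)} =
        (\<integral>\<^sup>+\<omega>. emeasure (eP n \<omega>) {?r (Suc n)} \<partial>C 0 n (\<lambda>_. undefined))"
      using meas[of "Suc n"] measurable_eP[of n] sp st
      by (simp, subst emeasure_bind[where N = "?M (Suc n)"])
         (auto simp: space_PiM measurable_cong_sets[OF st refl])
    also have "\<dots> = (\<integral>\<^sup>+\<omega>. emeasure (chain_step \<nu> P n (?r n)) {z n} * indicator {?r n} \<omega>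
                        \<partial>C 0 n (\<lambda>_. undefined))"
    proof (rule nn_integral_cong)
      fix \<omega> assume "\<omega> \<in> space (C 0 n (\<lambda>_. undefined))"
      then have \<omega>: "\<omega> \<in> space (?M n)" using sp by simp
      then have ext: "\<omega> \<in> extensional {0..<n}" by (simp add: space_PiM PiE_iff)
      have "fun_upd \<omega> n x = ?r (Suc n) \<longleftrightarrow> \<omega> = ?r n \<and> x = z n" for x
      proof
        assume eq: "fun_upd \<omega> n x = ?r (Suc n)"
        have "\<omega> i = ?r n i" for i
          using fun_cong[OF eq, of i] ext by (cases i n rule: linorder_cases) (auto simp: extensional_def)
        moreover have "x = z n" using fun_cong[OF eq, of n] by simp
        ultimately show "\<omega> = ?r n \<and> x = z n" by blast
      next
        assume "\<omega> = ?r n \<and> x = z n"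
        then show "fun_upd \<omega> n x = ?r (Suc n)" by (auto simp: fun_eq_iff restrict_def)
      qed
      then have "(\<lambda>x. fun_upd \<omega> n x) -` {?r (Suc n)} = {x. \<omega> = ?r n \<and> x = z n}"
        by (simp only: vimage_def singleton_iff)
      also have "\<dots> = (if \<omega> = ?r n then {z n} else {})"
        by (simp only: if_split) blast
      finally have vim: "(\<lambda>x. fun_upd \<omega> n x) -` {?r (Suc n)} = (if \<omega> = ?r n then {z n} else {})" .
      have cs: "chain_step \<nu> P n \<omega> = chain_step \<nu> P n (?r n)" if "\<omega> = ?r n"
        using that by simp
      show "emeasure (eP n \<omega>) {?r (Suc n)} =
          emeasure (chain_step \<nu> P n (?r n)) {z n} * indicator {?r n} \<omega>"
        unfolding emeasure_eP[OF \<omega> meas[of "Suc n"]] vim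
        by (cases "\<omega> = ?r n") (simp_all only: if_True if_False cs indicator_simps singleton_iff
            space_count_space Int_UNIV_right mult_1_right mult_zero_right Int_empty_left emeasure_empty
            simp_thms)
    qed
    also have "\<dots> = emeasure (chain_step \<nu> P n (?r n)) {z n} * emeasure (C 0 n (\<lambda>_. undefined)) {?r n}"
      using meas[of n] st by (subst nn_integral_cmult_indicator) auto
    finally show ?thesis by (simp add: mult.commute)
  qed
  have C: "emeasure (C 0 (Suc n) (\<lambda>_. undefined)) {?r (Suc n)} =
      ennreal (pmf \<nu> (z 0) * (\<Prod>i<n. pmf (P (z i)) (z (Suc i))))"
  proof (induction n)
    case 0
    have "emeasure (C 0 0 (\<lambda>_. undefined)) {?r 0} = 1"
      using meas[of 0] by (simp add: restrict_def)
    then show ?case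
      unfolding step[of 0] by (simp add: chain_step_def emeasure_pmf_single)
  next
    case (Suc n)
    have "emeasure (chain_step \<nu> P (Suc n) (?r (Suc n))) {z (Suc n)} = ennreal (pmf (P (z n)) (z (Suc n)))"
      by (simp add: chain_step_def emeasure_pmf_single)
    then show ?case
      unfolding step[of "Suc n"] Suc.IH
      by (simp add: ennreal_mult[symmetric] prod_nonneg mult.assoc)
  qed
  have emb: "PF.emb UNIV {0..<Suc n} {?r (Suc n)} = {\<omega>. \<forall>i\<le>n. \<omega> i = z i}"
    by (auto simp: prod_emb_def space_PiM fun_eq_iff restrict_def less_Suc_eq_le split: if_splits)
  have id: "PF.emb {0..<Suc n} {0..<Suc n} {?r (Suc n)} = {?r (Suc n)}"
    by (rule prod_emb_id) (use sets.sets_into_space[OF meas[of "Suc n"]] in \<open>simp add: space_PiM\<close>)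
  have "emeasure (chain_measure \<nu> P) {\<omega>. \<forall>i\<le>n. \<omega> i = z i} =
      emeasure (CI {0..<Suc n}) {?r (Suc n)}"
    unfolding chain_measure_def emb[symmetric] by (rule lim[OF _ meas]) simp
  also have "\<dots> = emeasure (C 0 (Suc n) (\<lambda>_. undefined)) {?r (Suc n)}"
    using emeasure_CI[OF subset_refl meas[of "Suc n"]] id by simp
  finally show ?thesis
    using C by simp
qed

lemma prob_space_chain_measure: "prob_space (chain_measure (\<nu> :: 's::finite pmf) P)"
proof -
  interpret Ionescu_Tulcea "chain_step \<nu> P" "\<lambda>_. count_space UNIV"
    by (rule Ionescu_Tulcea_chain)
  interpret CI: prob_space "CI {}"
    by (rule PF.prob_space_P) auto
  have sp: "space (CI {}) = {\<lambda>_. undefined}"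
    by (simp add: CI_def space_PiM)
  have "{\<lambda>_. undefined} \<in> sets (PiM {} (\<lambda>_. count_space (UNIV :: 's set)))"
    by (simp add: sets_PiM_empty)
  from lim[OF finite.emptyI this]
  have "emeasure (chain_measure \<nu> P) UNIV = 1"
    using CI.emeasure_space_1
    by (simp add: chain_measure_def sp prod_emb_def space_PiM restrict_def)
  then show ?thesis
    by (intro prob_spaceI) simp
qed

lemma measure_chain_cylinder:
  fixes \<nu> :: "'s::finite pmf"
  shows "measure (chain_measure \<nu> P) {\<omega>. \<forall>i\<le>n. \<omega> i = z i} =
           pmf \<nu> (z 0) * (\<Prod>i<n. pmf (P (z i)) (z (Suc i)))"
  using emeasure_chain_cylinder[of \<nu> P n z]
  by (simp add: measure_def prod_nonneg)

text \<open>In particular \<^const>\<open>esssup\<close> of the error norm is a genuine essential supremum, not the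
  default value for non-measurable functions.\<close>

lemma measurable_initial_error:
  fixes \<nu> :: "'s::finite pmf"
  shows "initial_error \<pi> F x\<^sub>0 T \<in> borel_measurable (sampling_space \<nu> P)"
proof -
  have [measurable]: "(\<lambda>\<omega>. \<omega> i) \<in> chain_measure \<nu> P \<rightarrow>\<^sub>M count_space UNIV" for i
    unfolding measurable_cong_sets[OF sets_chain_measure refl]
    by (rule measurable_component_singleton) simp
  have [measurable]: "mlmc_estimate T \<phi> j \<in> borel_measurable (chain_measure \<nu> P)"
    for \<phi> :: "'s \<Rightarrow> 'a" and j
    unfolding mlmc_estimate_def[abs_def] level_mean_def by measurable
  show ?thesis
    unfolding sampling_space_def initial_error_def case_prod_beta
    by (rule measurable_compose_countable'[where I=UNIV and g=fst]) measurable
qed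

lemma prob_space_sampling_space: "prob_space (sampling_space (\<nu> :: 's::finite pmf) P)"
proof -
  interpret A: prob_space "measure_pmf level_pmf" by (rule prob_space_measure_pmf)
  interpret B: prob_space "chain_measure \<nu> P" by (rule prob_space_chain_measure)
  interpret pair_prob_space "measure_pmf level_pmf" "chain_measure \<nu> P" ..
  show ?thesis
    unfolding sampling_space_def by unfold_locales
qed

end

theory Submission
  imports Defs
begin

text \<open>
  The scaled correction of level \<open>j \<ge> 1\<close>, which is \<open>2\<^sup>j\<close> times the difference of two consecutive
  level means, equals the sum of the gradients over the second half of the block of \<open>2\<^sup>j\<close> samples
  minus their sum over the first half (\<open>mlmc_estimate_halves\<close>).  It therefore has size
  \<open>2\<^sup>j\<close> times the noise level when the two halves carry opposite noise.

  The chain that jumps to a fair coin at every step, with the linear oracle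
  \<open>f(x; z) = \<plusminus> \<langle>x, v\<rangle>\<close> for a vector \<open>v\<close> of norm \<open>G\<^sub>\<sigma>\<close>, makes this happen: the objective
  vanishes, the noise has norm exactly \<open>G\<^sub>\<sigma>\<close> everywhere, and every finite path from an atom of the
  initial law has positive probability.  On the path with gradient \<open>- v\<close> on the first half and \<open>v\<close>
  on the second half of the block of the largest level \<open>J = j_max T\<close>, the error has norm
  \<open>(2 ^ J - 1) G\<^sub>\<sigma>\<close>, the \<open>- 1\<close> coming from the single sample of the base level
  (\<open>norm_signed_estimate\<close>).  Since the level is independent of the chain and equals \<open>J\<close> with
  positive probability, this is a lower bound for the essential supremum
  (\<open>esssup_sampling_space_ge\<close>), and \<open>2 ^ J > T / 2\<close> (\<open>half_lt_two_power_j_max\<close>).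
\<close>

section \<open>Essential suprema on the sampling space\<close>

text \<open>No measurability of \<open>f\<close> is assumed: for a non-measurable \<open>f\<close>, \<open>esssup M f = \<infinity>\<close> by convention.\<close>

lemma esssup_ge_of_emeasure_pos:
  fixes c :: ereal
  assumes N: "N \<in> sets M" "emeasure M N > 0"
    and ge: "\<And>s. s \<in> N \<Longrightarrow> c \<le> f s"
  shows "c \<le> esssup M f"
proof (rule ccontr)
  assume "\<not> c \<le> esssup M f"
  moreover have "AE s in M. f s \<le> esssup M f"
    by (rule esssup_AE)
  ultimately have "AE s in M. s \<notin> N"
    by (auto elim!: eventually_mono dest: ge)
  then have "emeasure M N = 0"
    using N(1) AE_iff_null_sets by blast
  with N(2) show False
    by simp
qed

text \<open>A bound that holds at one level and along one path segment of positive probability passes to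
  the essential supremum, because the level is independent of the chain.\<close>

lemma esssup_sampling_space_ge:
  fixes \<nu> :: "'s::finite pmf" and c :: ereal
  assumes j: "1 \<le> j"
    and pos: "pmf \<nu> (z 0) > 0" "\<And>i. i < n \<Longrightarrow> pmf (P (z i)) (z (Suc i)) > 0"
    and ge: "\<And>\<omega>. (\<And>i. i \<le> n \<Longrightarrow> \<omega> i = z i) \<Longrightarrow> c \<le> f (j, \<omega>)"
  shows "c \<le> esssup (sampling_space \<nu> P) f"
proof (rule esssup_ge_of_emeasure_pos)
  interpret C: prob_space "chain_measure \<nu> P"
    by (rule prob_space_chain_measure)
  let ?C = "{\<omega>. \<forall>i\<le>n. \<omega> i = z i}"
  have e: "emeasure (chain_measure \<nu> P) ?C > 0"
    unfolding emeasure_chain_cylinder using pos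
    by (auto intro!: mult_pos_pos prod_pos)
  then have C: "?C \<in> sets (chain_measure \<nu> P)"
    using emeasure_notin_sets by fastforce
  then show "{j} \<times> ?C \<in> sets (sampling_space \<nu> P)"
    unfolding sampling_space_def by (intro pair_measureI) auto
  have "emeasure (sampling_space \<nu> P) ({j} \<times> ?C) =
      ennreal (pmf level_pmf j) * emeasure (chain_measure \<nu> P) ?C"
    unfolding sampling_space_def using C
    by (subst C.emeasure_pair_measure_Times) (auto simp: emeasure_pmf_single)
  also have "\<dots> > 0"
    using e j by (simp add: pmf_level_pmf ennreal_zero_less_mult_iff)
  finally show "emeasure (sampling_space \<nu> P) ({j} \<times> ?C) > 0" .
  show "c \<le> f s" if "s \<in> {j} \<times> ?C" for s
    using that ge by auto
qed

section \<open>The top level of the estimator\<close>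

lemma mlmc_estimate_halves:
  assumes "Suc k \<le> j_max T"
  shows "mlmc_estimate T \<phi> (Suc k) \<omega> =
    \<phi> (\<omega> 1) + (\<Sum>i\<in>{2 ^ k<..2 ^ Suc k}. \<phi> (\<omega> i)) - (\<Sum>i = 1..2 ^ k. \<phi> (\<omega> i))"
proof -
  have "(\<Sum>i = 1..2 ^ Suc k. \<phi> (\<omega> i)) =
      (\<Sum>i = 1..2 ^ k. \<phi> (\<omega> i)) + (\<Sum>i\<in>{2 ^ k<..2 ^ Suc k}. \<phi> (\<omega> i))"
    by (subst sum.union_disjoint[symmetric]) (auto intro!: sum.cong)
  then show ?thesis
    using assms by (simp add: mlmc_estimate_def level_mean_def scaleR_right_diff_distrib scaleR_2)
qed

text \<open>The path carries \<open>- v\<close> on the first half of the block, including the sample that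
  the base level uses, and \<open>v\<close> on the second half.\<close>

lemma norm_signed_estimate:
  fixes v :: "'a::real_normed_vector"
  assumes "Suc k \<le> j_max T" and \<omega>: "\<And>i. 1 \<le> i \<Longrightarrow> i \<le> 2 ^ Suc k \<Longrightarrow> \<omega> i = (2 ^ k < i)"
  shows "norm (mlmc_estimate T (\<lambda>b. if b then v else - v) (Suc k) \<omega>) = (2 ^ Suc k - 1) * norm v"
proof -
  let ?\<phi> = "\<lambda>b. if b then v else - v"
  have \<omega>1: "\<not> \<omega> 1"
    using \<omega>[of 1] by simp
  have a: "(\<Sum>i\<in>{2 ^ k<..2 ^ Suc k}. ?\<phi> (\<omega> i)) = (\<Sum>i\<in>{2 ^ k<..2 ^ Suc k::nat}. v)"
    using \<omega> by (intro sum.cong) auto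
  have b: "(\<Sum>i = 1..2 ^ k. ?\<phi> (\<omega> i)) = (\<Sum>i = 1..2 ^ k::nat. - v)"
    using \<omega> by (intro sum.cong) auto
  have "mlmc_estimate T ?\<phi> (Suc k) \<omega> = (2 ^ Suc k - 1) *\<^sub>R v"
    unfolding mlmc_estimate_halves[OF assms(1)] a b using \<omega>1
    by (simp add: sum_constant_scaleR scaleR_left_diff_distrib scaleR_2 flip: scaleR_scaleR)
  moreover have "(0::real) \<le> 2 ^ Suc k - 1"
    using one_le_power[of "2::real" "Suc k"] by simp
  ultimately show ?thesis
    by (simp only: norm_scaleR abs_of_nonneg)
qed

lemma half_lt_two_power_j_max:
  assumes "1 \<le> T"
  shows "real T / 2 < 2 ^ j_max T"
proof -
  let ?l = "log 2 (real T)"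
  have "0 \<le> ?l"
    using assms by simp
  then have "?l < real (j_max T) + 1"
    unfolding j_max_def by linarith
  then have "real T < 2 powr (real (j_max T) + 1)"
    using assms by (subst (asm) log_less_iff) auto
  then show ?thesis
    by (simp add: powr_add powr_realpow)
qed

lemma j_max_pos: "2 \<le> T \<Longrightarrow> 1 \<le> j_max T"
  by (simp add: j_max_def le_nat_iff le_floor_iff le_log_iff)

section \<open>The linear oracle\<close>

lemma GDERIV_inner: "GDERIV (\<lambda>u. inner u D) x :> D"
  unfolding gderiv_def by (rule has_derivative_inner_left) (rule has_derivative_ident)

lemma gradient_inner [simp]:
  fixes D :: "'a::euclidean_space"
  shows "gradient (\<lambda>u. inner u D) x = D"
  by (rule gradient_eqI) (rule GDERIV_inner)

lemma gradient_zero [simp]: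
  fixes x :: "'a::euclidean_space"
  shows "gradient (\<lambda>u. 0) x = 0"
  using gradient_inner[of 0 x] by simp

text \<open>The linear oracle whose gradient is \<open>v\<close> in state \<open>True\<close> and \<open>- v\<close> in state \<open>False\<close>, at every point.\<close>

definition signed_linear :: "'a::euclidean_space \<Rightarrow> 'a \<Rightarrow> bool \<Rightarrow> real" where
  "signed_linear v x b = inner x (if b then v else - v)"

lemma gradient_signed_linear [simp]:
  "gradient (\<lambda>u. signed_linear v u b) x = (if b then v else - v)"
  unfolding signed_linear_def by (rule gradient_inner)

lemma objective_signed_linear [simp]:
  "objective (bernoulli_pmf (1 / 2)) (signed_linear v) = (\<lambda>x. 0)"
  by (simp add: objective_def signed_linear_def fun_eq_iff)

lemma smooth_unbiased_oracle_signed_linear: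
  "0 \<le> L \<Longrightarrow> smooth_unbiased_oracle X L (bernoulli_pmf (1 / 2)) (signed_linear v)"
  by (auto simp: smooth_unbiased_oracle_def)
    (auto simp: signed_linear_def integral_measure_pmf[of UNIV] UNIV_bool intro!: derivative_intros)

section \<open>The fair-coin chain\<close>

lemma d_TV_self [simp]: "d_TV p p = 0"
  by (simp add: d_TV_def)

text \<open>A kernel that forgets its state after one step is already mixed at time \<open>1\<close>.\<close>

lemma ergodic_sampling_const:
  fixes \<pi> :: "'s::finite pmf"
  assumes pos: "\<And>z. pmf \<pi> z > 0"
  shows "ergodic_sampling (\<lambda>_. \<pi>) \<pi>"
proof -
  have k1: "kernel_power (\<lambda>_. \<pi>) 1 z = \<pi>" for z
    by (simp add: bind_return_pmf)
  have "irreducible_kernel (\<lambda>_. \<pi>)"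
    unfolding irreducible_kernel_def using pos k1 by metis
  moreover have "aperiodic_kernel (\<lambda>_. \<pi>)"
    unfolding aperiodic_kernel_def
  proof
    fix x
    let ?S = "{k. 1 \<le> k \<and> pmf (kernel_power (\<lambda>_. \<pi>) k x) x > 0}"
    have "1 \<in> ?S"
      using pos k1 by simp
    then have "Gcd ?S dvd 1"
      by (rule Gcd_dvd)
    then show "Gcd ?S = 1"
      by simp
  qed
  moreover have "stationary (\<lambda>_. \<pi>) \<pi>"
    by (simp add: stationary_def)
  moreover have "tau_mix (\<lambda>_. \<pi>) \<pi> \<le> enat 1"
  proof -
    have "d_mix (\<lambda>_. \<pi>) \<pi> 1 = 0"
      unfolding d_mix_def k1 by simp
    then show ?thesis
      unfolding tau_mix_def by (intro INF_lower) simp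
  qed
  then have "tau_mix (\<lambda>_. \<pi>) \<pi> < \<infinity>"
    using enat_ord_simps(4) le_less_trans by blast
  ultimately show ?thesis
    by (simp add: ergodic_sampling_def ergodic_kernel_def)
qed

section \<open>The lower bound\<close>

lemma esssup_initial_error_signed_linear:
  fixes v x :: "'a::euclidean_space" and \<nu> :: "bool pmf"
  assumes T: "2 \<le> T"
  defines "\<pi> \<equiv> bernoulli_pmf (1 / 2)"
  shows "ereal ((2 ^ j_max T - 1) * norm v) \<le>
    esssup (sampling_space \<nu> (\<lambda>_. \<pi>)) (\<lambda>s. ereal (norm (initial_error \<pi> (signed_linear v) x T s)))"
proof -
  obtain k where k: "j_max T = Suc k"
    using j_max_pos[OF T] by (cases "j_max T") auto
  \<comment> \<open>The initial state is not sampled, so any atom of the initial law serves.\<close>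
  obtain a where a: "a \<in> set_pmf \<nu>"
    using set_pmf_not_empty[of \<nu>] by blast
  define z where "z i = (if i = 0 then a else 2 ^ k < i)" for i :: nat
  show ?thesis
  proof (rule esssup_sampling_space_ge[where j = "Suc k" and n = "2 ^ Suc k" and z = z])
    show "pmf \<nu> (z 0) > 0"
      using a by (simp add: z_def pmf_positive)
    show "pmf \<pi> (z (Suc i)) > 0" for i
      by (simp add: \<pi>_def pmf_bernoulli_half)
    fix \<omega> :: "nat \<Rightarrow> bool"
    assume "\<And>i. i \<le> 2 ^ Suc k \<Longrightarrow> \<omega> i = z i"
    then have "norm (mlmc_estimate T (\<lambda>b. if b then v else - v) (Suc k) \<omega>) = (2 ^ Suc k - 1) * norm v"
      by (intro norm_signed_estimate) (auto simp: k z_def)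
    then show "ereal ((2 ^ j_max T - 1) * norm v)
        \<le> ereal (norm (initial_error \<pi> (signed_linear v) x T (Suc k, \<omega>)))"
      by (simp add: initial_error_def \<pi>_def k)
  qed simp
qed

theorem proposition4p1:
  fixes X :: "(real ^ 'n) set" and x\<^sub>0 :: "real ^ 'n"
    and L G Ghat G\<sigma> :: real
  assumes "compact X" "convex X" "x\<^sub>0 \<in> X"
    and "0 \<le> L" "0 \<le> G" "G \<le> Ghat"
    and "G\<sigma> > 0"
  shows "\<exists>(P :: bool \<Rightarrow> bool pmf) (\<pi> :: bool pmf) (F :: real ^ 'n \<Rightarrow> bool \<Rightarrow> real).
           smooth_unbiased_oracle X L \<pi> F \<and>
           bounded_gradient X G \<pi> F \<and>
           bounded_noise X G\<sigma> \<pi> F \<and>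
           ergodic_sampling P \<pi> \<and>
           (\<forall>(\<nu> :: bool pmf) (T :: nat). 2 \<le> T \<longrightarrow>
              esssup (sampling_space \<nu> P) (\<lambda>s. ereal (norm (initial_error \<pi> F x\<^sub>0 T s)))
                \<ge> ereal ((real T / 2 - 1) * G\<sigma>))"
proof -
  obtain v :: "real ^ 'n" where v: "norm v = G\<sigma>"
    using vector_choose_size[of G\<sigma>] assms(7) by auto
  define \<pi> where "\<pi> = bernoulli_pmf (1 / 2)"
  have "smooth_unbiased_oracle X L \<pi> (signed_linear v)"
    unfolding \<pi>_def using assms(4) by (rule smooth_unbiased_oracle_signed_linear)
  moreover have "bounded_gradient X G \<pi> (signed_linear v)"
    using assms(5) by (simp add: bounded_gradient_def \<pi>_def)
  moreover have "bounded_noise X G\<sigma> \<pi> (signed_linear v)"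
    by (simp add: bounded_noise_def \<pi>_def v)
  moreover have "ergodic_sampling (\<lambda>_. \<pi>) \<pi>"
    by (rule ergodic_sampling_const) (simp add: \<pi>_def pmf_bernoulli_half)
  moreover have "ereal ((real T / 2 - 1) * G\<sigma>) \<le>
      esssup (sampling_space \<nu> (\<lambda>_. \<pi>)) (\<lambda>s. ereal (norm (initial_error \<pi> (signed_linear v) x\<^sub>0 T s)))"
    if T: "2 \<le> T" for \<nu> :: "bool pmf" and T
  proof -
    have "(real T / 2 - 1) * G\<sigma> \<le> (2 ^ j_max T - 1) * norm v"
      unfolding v using half_lt_two_power_j_max[of T] T assms(7)
      by (intro mult_right_mono) auto
    then show ?thesis
      using esssup_initial_error_signed_linear[OF T, of v \<nu> x\<^sub>0]
      unfolding \<pi>_def by (meson ereal_less_eq(3) order_trans)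
  qed
  ultimately show ?thesis
    by blast
qed

end
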